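(* Let $M^2: z=z(u,v)$ be a surface in $\mathbb R^4$ without flat points, and let $g$ be a tangent at a point $p\in M^2$. Then $g$ is principal if and only if its geodesic torsion vanishes, $\alpha_g=0$.
   Context: $M^2: z=z(u,v)$, $(u,v)\in\mathcal D\subset\mathbb R^2$, is a smooth regular 2-dimensional surface in Euclidean $\mathbb R^4$, with tangent space $T_pM^2=\mathrm{span}\{z_u,z_v\}$. $E,F,G$ are the coefficients of the first fundamental form $I(\lambda,\mu)=E\lambda^2+2F\lambda\mu+G\mu^2$, and $W=\sqrt{EG-F^2}$. $\{e_1,e_2\}$ is an orthonormal normal frame field chosen so that $\{z_u,z_v,e_1,e_2\}$ is positively oriented in $\mathbb R^4$. $\sigma$ is the vector-valued second fundamental tensor (normal part of the second derivative). The oriented area of the parallelogram of an ordered pair of normal vectors is $S(a^1e_1+a^2e_2,\;b^1e_1+b^2e_2)=a^1b^2-a^2b^1$. Put $L=\frac{2}{W}S(\sigma(z_u,z_u),\sigma(z_u,z_v))$, $M=\frac{1}{W}S(\sigma(z_u,z_u),\sigma(z_v,z_v))$, $N=\frac{2}{W}S(\sigma(z_u,z_v),\sigma(z_v,z_v))$. A point is flat if $L=M=N=0$ there. A tangent $g$ at $p$ is a line through the origin of $T_pM^2$, determined by a nonzero vector $X=\lambda z_u+\mu z_v$. For such $g$ define the linear map $\sigma_g:T_pM^2\to(T_pM^2)^\perp$, $\sigma_g(Y)=\sigma\left(\frac{\lambda z_u+\mu z_v}{\sqrt{I(\lambda,\mu)}},Y\right)$. For two tangents $g_1,g_2$ at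 $p$ define $$\zeta_{g_1,g_2}=\frac{S(\sigma_{g_1}(z_u),\sigma_{g_2}(z_v))}{W}+\frac{S(\sigma_{g_2}(z_u),\sigma_{g_1}(z_v))}{W}.$$ Two tangents $g_1,g_2$ are conjugate if $\zeta_{g_1,g_2}=0$. A tangent $g$ is principal if it is perpendicular to its conjugate, i.e. if there is a tangent conjugate to $g$ and perpendicular to $g$. The orthogonal tangent $g^\perp$ of $g$ is determined by $X^\perp=-\frac{F\lambda+G\mu}{W}z_u+\frac{E\lambda+F\mu}{W}z_v$. The geodesic torsion of $g$ is $\alpha_g=\zeta_{g,g^\perp}$ (computed with $X$ and $X^\perp$). *)

theory Defs
  imports "HOL-Analysis.Analysis"
begin

section \<open>Smooth functions of two variables\<close>

definition partial_u :: "(real \<times> real \<Rightarrow> 'b::real_normed_vector) \<Rightarrow> real \<times> real \<Rightarrow> 'b" where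
  "partial_u f p = vector_derivative (\<lambda>t. f (t, snd p)) (at (fst p))"

definition partial_v :: "(real \<times> real \<Rightarrow> 'b::real_normed_vector) \<Rightarrow> real \<times> real \<Rightarrow> 'b" where
  "partial_v f p = vector_derivative (\<lambda>t. f (fst p, t)) (at (snd p))"

primrec C_k_on :: "nat \<Rightarrow> (real \<times> real) set \<Rightarrow> (real \<times> real \<Rightarrow> 'b::real_normed_vector) \<Rightarrow> bool" where
  "C_k_on 0 D f \<longleftrightarrow> continuous_on D f"
| "C_k_on (Suc k) D f \<longleftrightarrow>
     f differentiable_on D \<and> C_k_on k D (partial_u f) \<and> C_k_on k D (partial_v f)"

text \<open>Only meaningful for open sets, since the partial derivatives are two-sided.\<close>

definition smooth_on :: "(real \<times> real) set \<Rightarrow> (real \<times> real \<Rightarrow> 'b::real_normed_vector) \<Rightarrow> bool" where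
  "smooth_on D f \<longleftrightarrow> (\<forall>k. C_k_on k D f)"

section \<open>Surfaces in Euclidean 4-space\<close>

text \<open>Points of the surface are represented by their parameters \<open>p = (u, v)\<close>.  In the regularity
  condition, \<open>z\<^sub>u \<noteq> z\<^sub>v\<close> is needed because \<open>{z\<^sub>u, z\<^sub>v}\<close> would otherwise collapse to a singleton.\<close>

definition regular_surface :: "(real \<times> real) set \<Rightarrow> (real \<times> real \<Rightarrow> real^4) \<Rightarrow> bool" where
  "regular_surface D z \<longleftrightarrow>
     open D \<and> smooth_on D z \<and>
     (\<forall>p\<in>D. partial_u z p \<noteq> partial_v z p \<and> independent {partial_u z p, partial_v z p})"

definition tangent_space :: "(real \<times> real \<Rightarrow> real^4) \<Rightarrow> real \<times> real \<Rightarrow> (real^4) set" where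
  "tangent_space z p = span {partial_u z p, partial_v z p}"

definition normal_plane :: "(real \<times> real \<Rightarrow> real^4) \<Rightarrow> real \<times> real \<Rightarrow> (real^4) set" where
  "normal_plane z p = orthogonal_comp (tangent_space z p)"

definition E_coeff :: "(real \<times> real \<Rightarrow> real^4) \<Rightarrow> real \<times> real \<Rightarrow> real" where
  "E_coeff z p = partial_u z p \<bullet> partial_u z p"

definition F_coeff :: "(real \<times> real \<Rightarrow> real^4) \<Rightarrow> real \<times> real \<Rightarrow> real" where
  "F_coeff z p = partial_u z p \<bullet> partial_v z p"

definition G_coeff :: "(real \<times> real \<Rightarrow> real^4) \<Rightarrow> real \<times> real \<Rightarrow> real" where
  "G_coeff z p = partial_v z p \<bullet> partial_v z p"

definition W_coeff :: "(real \<times> real \<Rightarrow> real^4) \<Rightarrow> real \<times> real \<Rightarrow> real" where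
  "W_coeff z p = sqrt (E_coeff z p * G_coeff z p - (F_coeff z p)\<^sup>2)"

definition first_form :: "(real \<times> real \<Rightarrow> real^4) \<Rightarrow> real \<times> real \<Rightarrow> real \<times> real \<Rightarrow> real" where
  "first_form z p c =
     E_coeff z p * (fst c)\<^sup>2 + 2 * F_coeff z p * fst c * snd c + G_coeff z p * (snd c)\<^sup>2"

text \<open>The frame \<open>e1, e2\<close> is defined on the parameter domain; the positivity of the determinant
  says that \<open>{z\<^sub>u, z\<^sub>v, e1, e2}\<close> is positively oriented.\<close>

definition oriented_normal_frame ::
  "(real \<times> real) set \<Rightarrow> (real \<times> real \<Rightarrow> real^4) \<Rightarrow> (real \<times> real \<Rightarrow> real^4) \<Rightarrow>
   (real \<times> real \<Rightarrow> real^4) \<Rightarrow> bool" where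
  "oriented_normal_frame D z e1 e2 \<longleftrightarrow>
     smooth_on D e1 \<and> smooth_on D e2 \<and>
     (\<forall>p\<in>D. e1 p \<in> normal_plane z p \<and> e2 p \<in> normal_plane z p \<and>
        norm (e1 p) = 1 \<and> norm (e2 p) = 1 \<and> e1 p \<bullet> e2 p = 0 \<and>
        det (vector [partial_u z p, partial_v z p, e1 p, e2 p] :: real^4^4) > 0)"

section \<open>Second fundamental tensor\<close>

text \<open>The tangent vector with coordinates \<open>c = (\<lambda>, \<mu>)\<close> in the basis \<open>z\<^sub>u, z\<^sub>v\<close>, and conversely
  the coordinates of a tangent vector.\<close>

definition tangent_vec :: "(real \<times> real \<Rightarrow> real^4) \<Rightarrow> real \<times> real \<Rightarrow> real \<times> real \<Rightarrow> real^4" where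
  "tangent_vec z p c = fst c *\<^sub>R partial_u z p + snd c *\<^sub>R partial_v z p"

definition tangent_coords :: "(real \<times> real \<Rightarrow> real^4) \<Rightarrow> real \<times> real \<Rightarrow> real^4 \<Rightarrow> real \<times> real" where
  "tangent_coords z p X = (THE c. tangent_vec z p c = X)"

definition normal_part :: "(real \<times> real \<Rightarrow> real^4) \<Rightarrow> real \<times> real \<Rightarrow> real^4 \<Rightarrow> real^4" where
  "normal_part z p x = (THE n. n \<in> normal_plane z p \<and> x - n \<in> tangent_space z p)"

definition second_deriv ::
  "(real \<times> real \<Rightarrow> real^4) \<Rightarrow> real \<times> real \<Rightarrow> real \<times> real \<Rightarrow> real \<times> real \<Rightarrow> real^4" where
  "second_deriv z p c d =
     (fst c * fst d) *\<^sub>R partial_u (partial_u z) p +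
     (fst c * snd d + snd c * fst d) *\<^sub>R partial_v (partial_u z) p +
     (snd c * snd d) *\<^sub>R partial_v (partial_v z) p"

definition sff :: "(real \<times> real \<Rightarrow> real^4) \<Rightarrow> real \<times> real \<Rightarrow> real^4 \<Rightarrow> real^4 \<Rightarrow> real^4" where
  "sff z p X Y = normal_part z p (second_deriv z p (tangent_coords z p X) (tangent_coords z p Y))"

text \<open>The oriented area \<open>S(a, b) = a\<^sup>1 b\<^sup>2 - a\<^sup>2 b\<^sup>1\<close> of two normal vectors at a point, with
  components taken in the orthonormal frame \<open>n1, n2\<close> at that point.\<close>

definition oriented_area :: "real^4 \<Rightarrow> real^4 \<Rightarrow> real^4 \<Rightarrow> real^4 \<Rightarrow> real" where
  "oriented_area n1 n2 a b = (a \<bullet> n1) * (b \<bullet> n2) - (a \<bullet> n2) * (b \<bullet> n1)"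

definition L_coeff ::
  "(real \<times> real \<Rightarrow> real^4) \<Rightarrow> (real \<times> real \<Rightarrow> real^4) \<Rightarrow> (real \<times> real \<Rightarrow> real^4) \<Rightarrow> real \<times> real \<Rightarrow> real" where
  "L_coeff z e1 e2 p = 2 / W_coeff z p *
     oriented_area (e1 p) (e2 p) (sff z p (partial_u z p) (partial_u z p))
       (sff z p (partial_u z p) (partial_v z p))"

definition M_coeff ::
  "(real \<times> real \<Rightarrow> real^4) \<Rightarrow> (real \<times> real \<Rightarrow> real^4) \<Rightarrow> (real \<times> real \<Rightarrow> real^4) \<Rightarrow> real \<times> real \<Rightarrow> real" where
  "M_coeff z e1 e2 p = 1 / W_coeff z p *
     oriented_area (e1 p) (e2 p) (sff z p (partial_u z p) (partial_u z p))
       (sff z p (partial_v z p) (partial_v z p))"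

definition N_coeff ::
  "(real \<times> real \<Rightarrow> real^4) \<Rightarrow> (real \<times> real \<Rightarrow> real^4) \<Rightarrow> (real \<times> real \<Rightarrow> real^4) \<Rightarrow> real \<times> real \<Rightarrow> real" where
  "N_coeff z e1 e2 p = 2 / W_coeff z p *
     oriented_area (e1 p) (e2 p) (sff z p (partial_u z p) (partial_v z p))
       (sff z p (partial_v z p) (partial_v z p))"

definition flat_point ::
  "(real \<times> real \<Rightarrow> real^4) \<Rightarrow> (real \<times> real \<Rightarrow> real^4) \<Rightarrow> (real \<times> real \<Rightarrow> real^4) \<Rightarrow> real \<times> real \<Rightarrow> bool" where
  "flat_point z e1 e2 p \<longleftrightarrow>
     L_coeff z e1 e2 p = 0 \<and> M_coeff z e1 e2 p = 0 \<and> N_coeff z e1 e2 p = 0"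

section \<open>Conjugate and principal tangents, geodesic torsion\<close>

definition tangent_line :: "(real \<times> real \<Rightarrow> real^4) \<Rightarrow> real \<times> real \<Rightarrow> real \<times> real \<Rightarrow> (real^4) set" where
  "tangent_line z p c = span {tangent_vec z p c}"

definition is_tangent :: "(real \<times> real \<Rightarrow> real^4) \<Rightarrow> real \<times> real \<Rightarrow> (real^4) set \<Rightarrow> bool" where
  "is_tangent z p g \<longleftrightarrow> (\<exists>c. c \<noteq> (0, 0) \<and> g = tangent_line z p c)"

text \<open>The map \<open>\<sigma>\<^sub>g\<close> and the number \<open>\<zeta>\<close> depend on the vectors \<open>c = (\<lambda>, \<mu>)\<close> that determine the
  tangents only up to sign (see \<open>zeta_scale\<close> below), so they are functions of these vectors.\<close>

definition sigma_dir :: "(real \<times> real \<Rightarrow> real^4) \<Rightarrow> real \<times> real \<Rightarrow> real \<times> real \<Rightarrow> real^4 \<Rightarrow> real^4" where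
  "sigma_dir z p c Y = sff z p (tangent_vec z p c /\<^sub>R sqrt (first_form z p c)) Y"

definition zeta ::
  "(real \<times> real \<Rightarrow> real^4) \<Rightarrow> (real \<times> real \<Rightarrow> real^4) \<Rightarrow> (real \<times> real \<Rightarrow> real^4) \<Rightarrow>
   real \<times> real \<Rightarrow> real \<times> real \<Rightarrow> real \<times> real \<Rightarrow> real" where
  "zeta z e1 e2 p c1 c2 =
     oriented_area (e1 p) (e2 p) (sigma_dir z p c1 (partial_u z p)) (sigma_dir z p c2 (partial_v z p))
       / W_coeff z p +
     oriented_area (e1 p) (e2 p) (sigma_dir z p c2 (partial_u z p)) (sigma_dir z p c1 (partial_v z p))
       / W_coeff z p"

definition conjugate_tangents ::
  "(real \<times> real \<Rightarrow> real^4) \<Rightarrow> (real \<times> real \<Rightarrow> real^4) \<Rightarrow> (real \<times> real \<Rightarrow> real^4) \<Rightarrow>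
   real \<times> real \<Rightarrow> (real^4) set \<Rightarrow> (real^4) set \<Rightarrow> bool" where
  "conjugate_tangents z e1 e2 p g1 g2 \<longleftrightarrow>
     (\<exists>c1 c2. c1 \<noteq> (0, 0) \<and> c2 \<noteq> (0, 0) \<and> g1 = tangent_line z p c1 \<and> g2 = tangent_line z p c2 \<and>
        zeta z e1 e2 p c1 c2 = 0)"

definition principal_tangent ::
  "(real \<times> real \<Rightarrow> real^4) \<Rightarrow> (real \<times> real \<Rightarrow> real^4) \<Rightarrow> (real \<times> real \<Rightarrow> real^4) \<Rightarrow>
   real \<times> real \<Rightarrow> (real^4) set \<Rightarrow> bool" where
  "principal_tangent z e1 e2 p g \<longleftrightarrow> is_tangent z p g \<and>
     (\<exists>h. is_tangent z p h \<and> conjugate_tangents z e1 e2 p g h \<and> (\<forall>x\<in>g. \<forall>y\<in>h. orthogonal x y))"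

definition perp_coords :: "(real \<times> real \<Rightarrow> real^4) \<Rightarrow> real \<times> real \<Rightarrow> real \<times> real \<Rightarrow> real \<times> real" where
  "perp_coords z p c =
     (- ((F_coeff z p * fst c + G_coeff z p * snd c) / W_coeff z p),
      (E_coeff z p * fst c + F_coeff z p * snd c) / W_coeff z p)"

text \<open>Independent of the vector \<open>c\<close> determining the tangent: see \<open>geodesic_torsion_scale\<close>.\<close>

definition geodesic_torsion ::
  "(real \<times> real \<Rightarrow> real^4) \<Rightarrow> (real \<times> real \<Rightarrow> real^4) \<Rightarrow> (real \<times> real \<Rightarrow> real^4) \<Rightarrow>
   real \<times> real \<Rightarrow> real \<times> real \<Rightarrow> real" where
  "geodesic_torsion z e1 e2 p c = zeta z e1 e2 p c (perp_coords z p c)"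

section \<open>Independence of the representing vectors\<close>

lemma tangent_coords_vec:
  assumes "regular_surface D z" "p \<in> D"
  shows "tangent_coords z p (tangent_vec z p c) = c"
proof -
  let ?u = "partial_u z p" and ?v = "partial_v z p"
  have ne: "?u \<noteq> ?v" and ind: "independent {?u, ?v}"
    using assms by (auto simp: regular_surface_def)
  have "d = c" if "tangent_vec z p d = tangent_vec z p c" for d
  proof -
    define f where "f = (\<lambda>w. if w = ?u then fst d - fst c else snd d - snd c)"
    have f: "f ?u = fst d - fst c" "f ?v = snd d - snd c"
      using ne by (auto simp: f_def)
    have "(\<Sum>w\<in>{?u, ?v}. f w *\<^sub>R w) = f ?u *\<^sub>R ?u + f ?v *\<^sub>R ?v"
      using ne by simp
    also have "\<dots> = tangent_vec z p d - tangent_vec z p c"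
      unfolding f by (simp add: tangent_vec_def algebra_simps)
    finally have sum0: "(\<Sum>w\<in>{?u, ?v}. f w *\<^sub>R w) = 0"
      using that by simp
    have "f w = 0" if "w \<in> {?u, ?v}" for w
      by (rule independentD[OF ind _ subset_refl sum0 that]) simp
    then have "f ?u = 0" "f ?v = 0"
      by blast+
    then show ?thesis
      unfolding f by (simp add: prod_eq_iff)
  qed
  then show ?thesis unfolding tangent_coords_def by (intro the_equality) auto
qed

lemma normal_part_eqI:
  assumes "n \<in> normal_plane z p" "x - n \<in> tangent_space z p"
  shows "normal_part z p x = n"
  unfolding normal_part_def
proof (rule the_equality)
  fix m assume m: "m \<in> normal_plane z p \<and> x - m \<in> tangent_space z p"
  have "(x - n) - (x - m) \<in> tangent_space z p"
    using m assms unfolding tangent_space_def by (blast intro: span_diff)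
  then have t: "m - n \<in> tangent_space z p" by simp
  have "orthogonal (m - n) m" "orthogonal (m - n) n"
    using t m assms by (auto simp: normal_plane_def orthogonal_comp_def)
  then have "(m - n) \<bullet> (m - n) = 0"
    by (simp add: orthogonal_def inner_diff_right)
  then show "m = n" by simp
qed (use assms in auto)

lemma normal_part_scaleR: "normal_part z p (k *\<^sub>R x) = k *\<^sub>R normal_part z p x"
proof -
  obtain y n where yn: "y \<in> tangent_space z p" "\<And>w. w \<in> tangent_space z p \<Longrightarrow> orthogonal n w" "x = y + n"
    using orthogonal_subspace_decomp_exists[of "{partial_u z p, partial_v z p}" x]
    unfolding tangent_space_def by metis
  have n: "n \<in> normal_plane z p"
    using yn(2) by (auto simp: normal_plane_def orthogonal_comp_def orthogonal_commute)
  have 1: "normal_part z p x = n" using n yn by (intro normal_part_eqI) auto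
  have "normal_part z p (k *\<^sub>R x) = k *\<^sub>R n"
  proof (rule normal_part_eqI)
    show "k *\<^sub>R n \<in> normal_plane z p"
      using n by (auto simp: normal_plane_def orthogonal_comp_def orthogonal_clauses)
    have "k *\<^sub>R x - k *\<^sub>R n = k *\<^sub>R y" using yn by (simp add: algebra_simps)
    then show "k *\<^sub>R x - k *\<^sub>R n \<in> tangent_space z p"
      using yn(1) unfolding tangent_space_def by (simp add: span_scale)
  qed
  then show ?thesis using 1 by simp
qed

lemma sigma_dir_scale:
  assumes "regular_surface D z" "p \<in> D"
  shows "sigma_dir z p (a *\<^sub>R c) Y = sgn a *\<^sub>R sigma_dir z p c Y"
proof -
  have ff: "first_form z p (a *\<^sub>R c) = a\<^sup>2 * first_form z p c"
    by (simp add: first_form_def power2_eq_square algebra_simps)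
  have scale: "r *\<^sub>R tangent_vec z p d = tangent_vec z p (r *\<^sub>R d)" for r d
    by (simp add: tangent_vec_def algebra_simps)
  have dir: "sigma_dir z p d Y = inverse (sqrt (first_form z p d)) *\<^sub>R
      normal_part z p (second_deriv z p d (tangent_coords z p Y))" for d
  proof -
    have "second_deriv z p (r *\<^sub>R d) e = r *\<^sub>R second_deriv z p d e" for r e
      by (simp add: second_deriv_def algebra_simps)
    then show ?thesis
      unfolding sigma_dir_def sff_def scale tangent_coords_vec[OF assms]
      by (simp add: normal_part_scaleR)
  qed
  have "second_deriv z p (a *\<^sub>R c) e = a *\<^sub>R second_deriv z p c e" for e
    by (simp add: second_deriv_def algebra_simps)
  moreover have "inverse (sqrt (a\<^sup>2 * t)) * a = sgn a * inverse (sqrt t)" for t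
    by (cases "a = 0") (auto simp: real_sqrt_mult sgn_real_def abs_if)
  ultimately show ?thesis
    unfolding dir ff by (simp only: normal_part_scaleR scaleR_scaleR)
qed

lemma zeta_scale:
  assumes "regular_surface D z" "p \<in> D"
  shows "zeta z e1 e2 p (a *\<^sub>R c) (b *\<^sub>R d) = sgn a * sgn b * zeta z e1 e2 p c d"
proof -
  have area: "oriented_area n1 n2 (r *\<^sub>R x) (t *\<^sub>R y) = r * t * oriented_area n1 n2 x y" for n1 n2 r t x y
    by (simp add: oriented_area_def right_diff_distrib)
  show ?thesis
    unfolding zeta_def sigma_dir_scale[OF assms] area
    by (simp add: distrib_left mult.commute)
qed

lemma geodesic_torsion_scale:
  assumes "regular_surface D z" "p \<in> D" "a \<noteq> 0"
  shows "geodesic_torsion z e1 e2 p (a *\<^sub>R c) = geodesic_torsion z e1 e2 p c"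
proof -
  have "perp_coords z p (a *\<^sub>R c) = a *\<^sub>R perp_coords z p c"
    by (simp add: perp_coords_def algebra_simps add_divide_distrib)
  then show ?thesis
    using assms(3) by (simp add: geodesic_torsion_def zeta_scale[OF assms(1,2)] sgn_if)
qed

end

theory Submission
  imports Defs
begin

text \<open>
  The tangent plane is two-dimensional and the first fundamental form is positive definite on it,
  so the vectors orthogonal to a nonzero tangent vector \<open>X\<close> form a line, and this line is spanned
  by \<open>X\<^sup>\<bottom>\<close> (\<open>orthogonal_tangent_vec_iff\<close>).  Hence \<open>g\<^sup>\<bottom>\<close> is the only candidate for a tangent that is
  both conjugate and perpendicular to \<open>g\<close>, and \<open>g\<close> is principal exactly if \<open>g\<close> and \<open>g\<^sup>\<bottom>\<close> are
  conjugate, that is, if \<open>\<zeta>\<close> vanishes for them, and this value of \<open>\<zeta>\<close> is by definition \<open>\<alpha>\<^sub>g\<close>.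

  Conjugacy of two lines only asks for \<^emph>\<open>some\<close> representing vectors with \<open>\<zeta> = 0\<close>.  A change of
  representatives multiplies \<open>\<zeta>\<close> by a sign (\<open>zeta_scale\<close>), so the vectors \<open>X\<close> and \<open>X\<^sup>\<bottom>\<close> can be
  used as well (\<open>conjugate_tangents_iff\<close>).
\<close>

lemma tangent_vec_scaleR: "tangent_vec z p (k *\<^sub>R c) = k *\<^sub>R tangent_vec z p c"
  by (simp add: tangent_vec_def algebra_simps)

lemma tangent_vec_eq_iff:
  assumes "regular_surface D z" "p \<in> D"
  shows "tangent_vec z p c = tangent_vec z p d \<longleftrightarrow> c = d"
  by (metis tangent_coords_vec[OF assms])

lemma tangent_vec_eq_0_iff:
  assumes "regular_surface D z" "p \<in> D"
  shows "tangent_vec z p c = 0 \<longleftrightarrow> c = (0, 0)"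
  using tangent_vec_eq_iff[OF assms, of c "(0, 0)"] by (simp add: tangent_vec_def)

lemma inner_tangent_vec:
  "tangent_vec z p c \<bullet> tangent_vec z p d =
     (E_coeff z p * fst c + F_coeff z p * snd c) * fst d +
     (F_coeff z p * fst c + G_coeff z p * snd c) * snd d"
  by (simp add: tangent_vec_def E_coeff_def F_coeff_def G_coeff_def inner_add_left inner_add_right
      inner_commute[of "partial_v z p" "partial_u z p"] algebra_simps)

text \<open>The tangent vector \<open>F z\<^sub>u - E z\<^sub>v\<close> is \<open>- E\<close> times the component of \<open>z\<^sub>v\<close> orthogonal to \<open>z\<^sub>u\<close>.
  Its squared length is \<open>E (E G - F\<^sup>2)\<close>, and both this and \<open>E\<close> are positive because
  \<open>z\<^sub>u\<close> and \<open>z\<^sub>v\<close> are linearly independent.\<close>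

lemma W_coeff_pos:
  assumes "regular_surface D z" "p \<in> D"
  shows "W_coeff z p > 0"
proof -
  let ?E = "E_coeff z p" and ?F = "F_coeff z p" and ?G = "G_coeff z p"
  have pos: "tangent_vec z p c \<bullet> tangent_vec z p c > 0" if "c \<noteq> (0, 0)" for c
    using that by (simp add: tangent_vec_eq_0_iff[OF assms])
  have E: "?E > 0"
    using pos[of "(1, 0)"] by (simp add: inner_tangent_vec)
  have "tangent_vec z p (?F, - ?E) \<bullet> tangent_vec z p (?F, - ?E) = ?E * (?E * ?G - ?F\<^sup>2)"
    by (simp add: inner_tangent_vec power2_eq_square algebra_simps)
  with pos[of "(?F, - ?E)"] E have "?E * ?G - ?F\<^sup>2 > 0"
    by (simp add: zero_less_mult_iff)
  then show ?thesis by (simp add: W_coeff_def)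
qed

text \<open>With \<open>X = \<lambda> z\<^sub>u + \<mu> z\<^sub>v\<close>, \<open>A = E \<lambda> + F \<mu>\<close> and \<open>B = F \<lambda> + G \<mu>\<close>, orthogonality of \<open>X\<close> to the vector
  with coordinates \<open>(x, y)\<close> is the single linear equation \<open>A x + B y = 0\<close>.  It is nontrivial because
  \<open>\<lambda> A + \<mu> B\<close> is the squared length of \<open>X\<close>, so its solutions are the multiples of \<open>(- B, A)\<close>,
  which is \<open>W\<close> times the coordinate vector of \<open>X\<^sup>\<bottom>\<close>.\<close>

lemma orthogonal_tangent_vec_iff:
  assumes "regular_surface D z" "p \<in> D" "c \<noteq> (0, 0)"
  shows "orthogonal (tangent_vec z p c) (tangent_vec z p d) \<longleftrightarrow> (\<exists>k. d = k *\<^sub>R perp_coords z p c)"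
proof -
  define A where "A = E_coeff z p * fst c + F_coeff z p * snd c"
  define B where "B = F_coeff z p * fst c + G_coeff z p * snd c"
  define W where "W = W_coeff z p"
  have W: "W > 0"
    unfolding W_def by (rule W_coeff_pos[OF assms(1,2)])
  have perp: "perp_coords z p c = (- (B / W), A / W)"
    by (simp add: perp_coords_def A_def B_def W_def)
  have orth: "orthogonal (tangent_vec z p c) (tangent_vec z p d) \<longleftrightarrow> A * fst d + B * snd d = 0"
    by (simp add: orthogonal_def inner_tangent_vec A_def B_def)
  have "tangent_vec z p c \<bullet> tangent_vec z p c \<noteq> 0"
    using assms(3) by (simp add: tangent_vec_eq_0_iff[OF assms(1,2)])
  then have "A * fst c + B * snd c \<noteq> 0"
    by (simp only: inner_tangent_vec A_def B_def not_False_eq_True)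
  then have AB: "A\<^sup>2 + B\<^sup>2 \<noteq> 0"
    by (auto simp: sum_power2_eq_zero_iff)
  show ?thesis
  proof
    assume "orthogonal (tangent_vec z p c) (tangent_vec z p d)"
    then have eq: "A * fst d + B * snd d = 0"
      by (simp add: orth)
    \<comment> \<open>\<open>(A y - B x) / (A\<^sup>2 + B\<^sup>2)\<close> is the coefficient of the projection of \<open>(x, y)\<close> onto \<open>(- B, A)\<close> in
      the standard inner product of the plane.\<close>
    define q where "q = (A * snd d - B * fst d) / (A\<^sup>2 + B\<^sup>2)"
    have "(A\<^sup>2 + B\<^sup>2) * fst d = (A\<^sup>2 + B\<^sup>2) * (- B * q)"
    proof -
      have "(A\<^sup>2 + B\<^sup>2) * fst d = - B * (A * snd d - B * fst d)"
        using eq by algebra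
      also have "\<dots> = (A\<^sup>2 + B\<^sup>2) * (- B * q)"
        using AB by (simp add: q_def)
      finally show ?thesis .
    qed
    moreover have "(A\<^sup>2 + B\<^sup>2) * snd d = (A\<^sup>2 + B\<^sup>2) * (A * q)"
    proof -
      have "(A\<^sup>2 + B\<^sup>2) * snd d = A * (A * snd d - B * fst d)"
        using eq by algebra
      also have "\<dots> = (A\<^sup>2 + B\<^sup>2) * (A * q)"
        using AB by (simp add: q_def)
      finally show ?thesis .
    qed
    ultimately have "fst d = - B * q" "snd d = A * q"
      using mult_left_cancel[OF AB] by blast+
    then have "d = (W * q) *\<^sub>R perp_coords z p c"
      using W by (simp add: perp prod_eq_iff)
    then show "\<exists>k. d = k *\<^sub>R perp_coords z p c" ..
  next
    assume "\<exists>k. d = k *\<^sub>R perp_coords z p c"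
    then show "orthogonal (tangent_vec z p c) (tangent_vec z p d)"
      by (auto simp: orth perp)
  qed
qed

lemma perp_coords_nonzero:
  assumes "regular_surface D z" "p \<in> D" "c \<noteq> (0, 0)"
  shows "perp_coords z p c \<noteq> (0, 0)"
proof
  assume "perp_coords z p c = (0, 0)"
  then have "tangent_vec z p c \<bullet> tangent_vec z p c = 0"
    using W_coeff_pos[OF assms(1,2)] by (simp add: perp_coords_def inner_tangent_vec)
  then show False
    using assms(3) by (simp add: tangent_vec_eq_0_iff[OF assms(1,2)])
qed

lemma tangent_line_eqD:
  assumes "regular_surface D z" "p \<in> D" "c \<noteq> (0, 0)" "tangent_line z p c = tangent_line z p d"
  obtains a where "a \<noteq> 0" "c = a *\<^sub>R d"
proof -
  have "tangent_vec z p c \<in> tangent_line z p d"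
    using assms(4) by (metis tangent_line_def span_base singletonI)
  then obtain a where "tangent_vec z p c = tangent_vec z p (a *\<^sub>R d)"
    by (auto simp: tangent_line_def span_singleton tangent_vec_scaleR)
  then have "c = a *\<^sub>R d"
    by (simp add: tangent_vec_eq_iff[OF assms(1,2)])
  moreover from this have "a \<noteq> 0"
    using assms(3) by (auto simp: zero_prod_def)
  ultimately show thesis by (rule that[rotated])
qed

text \<open>Any representing vectors test conjugacy, since other ones change \<open>\<zeta>\<close> by a sign only.\<close>

lemma conjugate_tangents_iff:
  assumes "regular_surface D z" "p \<in> D" "c \<noteq> (0, 0)" "d \<noteq> (0, 0)"
  shows "conjugate_tangents z e1 e2 p (tangent_line z p c) (tangent_line z p d) \<longleftrightarrow>
    zeta z e1 e2 p c d = 0"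
proof
  assume "conjugate_tangents z e1 e2 p (tangent_line z p c) (tangent_line z p d)"
  then obtain c1 c2
    where lines: "tangent_line z p c = tangent_line z p c1" "tangent_line z p d = tangent_line z p c2"
      and zero: "zeta z e1 e2 p c1 c2 = 0"
    by (auto simp: conjugate_tangents_def)
  obtain a where "c = a *\<^sub>R c1"
    using tangent_line_eqD[OF assms(1-3) lines(1)] .
  moreover obtain b where "d = b *\<^sub>R c2"
    using tangent_line_eqD[OF assms(1,2,4) lines(2)] .
  ultimately show "zeta z e1 e2 p c d = 0"
    by (simp add: zeta_scale[OF assms(1,2)] zero)
next
  assume "zeta z e1 e2 p c d = 0"
  with assms(3,4) show "conjugate_tangents z e1 e2 p (tangent_line z p c) (tangent_line z p d)"
    unfolding conjugate_tangents_def by blast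
qed

lemma orthogonal_tangent_lines_iff:
  "(\<forall>x\<in>tangent_line z p c. \<forall>y\<in>tangent_line z p d. orthogonal x y) \<longleftrightarrow>
    orthogonal (tangent_vec z p c) (tangent_vec z p d)"
proof
  assume "\<forall>x\<in>tangent_line z p c. \<forall>y\<in>tangent_line z p d. orthogonal x y"
  then show "orthogonal (tangent_vec z p c) (tangent_vec z p d)"
    by (simp add: tangent_line_def span_base)
qed (auto simp: tangent_line_def span_singleton orthogonal_clauses)

theorem proposition2p6:
  fixes z e1 e2 :: "real \<times> real \<Rightarrow> real^4"
    and D :: "(real \<times> real) set"
    and p c :: "real \<times> real"
    and g :: "(real^4) set"
  assumes "regular_surface D z"
    and "oriented_normal_frame D z e1 e2"
    and "\<forall>q\<in>D. \<not> flat_point z e1 e2 q"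
    and "p \<in> D"
    and "c \<noteq> (0, 0)"
    and "g = tangent_line z p c"
  shows "principal_tangent z e1 e2 p g \<longleftrightarrow> geodesic_torsion z e1 e2 p c = 0"
proof
  assume "principal_tangent z e1 e2 p g"
  then obtain d where d: "d \<noteq> (0, 0)"
    and conj: "conjugate_tangents z e1 e2 p (tangent_line z p c) (tangent_line z p d)"
    and "\<forall>x\<in>tangent_line z p c. \<forall>y\<in>tangent_line z p d. orthogonal x y"
    using assms(6) by (auto simp: principal_tangent_def is_tangent_def)
  then obtain k where k: "d = k *\<^sub>R perp_coords z p c"
    by (auto simp: orthogonal_tangent_lines_iff orthogonal_tangent_vec_iff[OF assms(1,4,5)])
  then have "k \<noteq> 0"
    using d by (auto simp: zero_prod_def)
  moreover have "zeta z e1 e2 p c (k *\<^sub>R perp_coords z p c) = 0"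
    using conj conjugate_tangents_iff[OF assms(1,4,5) d] k by simp
  ultimately show "geodesic_torsion z e1 e2 p c = 0"
    using zeta_scale[OF assms(1,4), of e1 e2 1 c k "perp_coords z p c"]
    by (simp add: geodesic_torsion_def sgn_zero_iff)
next
  let ?d = "perp_coords z p c"
  assume "geodesic_torsion z e1 e2 p c = 0"
  moreover have d: "?d \<noteq> (0, 0)"
    by (rule perp_coords_nonzero[OF assms(1,4,5)])
  ultimately have "conjugate_tangents z e1 e2 p g (tangent_line z p ?d)"
    using assms(6) conjugate_tangents_iff[OF assms(1,4,5) d] by (simp add: geodesic_torsion_def)
  moreover have "\<exists>k. ?d = k *\<^sub>R ?d"
    by (rule exI[of _ 1]) simp
  then have "\<forall>x\<in>g. \<forall>y\<in>tangent_line z p ?d. orthogonal x y"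
    unfolding assms(6) orthogonal_tangent_lines_iff orthogonal_tangent_vec_iff[OF assms(1,4,5)] .
  ultimately show "principal_tangent z e1 e2 p g"
    using assms(5,6) d unfolding principal_tangent_def is_tangent_def by blast
qed

end
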